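(* Let $G=\langle V\cup\{s\},E\rangle$ be a weighted undirected graph with source $s$ and edge costs $c_{(i,j)}\ge 0$. The average marginal cost mechanism (AMCM) $(g,f,x)$ satisfies budget balance: for every report profile $\theta'\in\Theta$, $$\sum_{i\in V}x_i(\theta')=\sum_{(i,j)\in f(\theta')}c_{(i,j)}.$$
   Context: Setting. $G=\langle V\cup\{s\},E\rangle$ is a finite weighted undirected graph; $s$ is the source, and each edge $(i,j)\in E$ has cost $c_{(i,j)}\ge 0$. For $i\in V\cup\{s\}$, $\Theta_i$ is the set of all sets of edges of $E$ adjacent to $i$, and $\Theta=\prod_{i\in V\cup\{s\}}\Theta_i$. A report profile $\theta'\in\Theta$ induces the graph $G_{\theta'}=\langle V\cup\{s\},E_{\theta'}\rangle$ with $E_{\theta'}=\{(i,j)\in E : (i,j)\in\theta_i'\cap\theta_j'\}$. A cost sharing mechanism $(g,f,x)$ assigns to each $\theta'\in\Theta$ a set $g(\theta')\subseteq V$ of selected (connected) nodes, a set $f(\theta')\subseteq E_{\theta'}$ of selected edges connecting the nodes of $g(\theta')$ (to the source), and cost shares $x_i(\theta')\in\mathbb{R}$ for $i\in V$, with $x_i(\theta')=0$ if $i\notin g(\theta')$. AMCM. Given $\theta'\in\Theta$: compute, by Prim's algorithm started at $s$, a minimum spanning tree (of the connected component of $s$) in $G_{\theta'}$. Let $g(\theta')$ be the set of nodes other than $s$ in this tree (i.e. the nodes of $V$ connected to $s$ in $G_{\theta'}$) and $f(\theta')$ its edge set. For $S\subseteq g(\theta')$ let $v(S)$ be the minimum cost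 to connect $S$ to $s$ in $G_{\theta'}$, i.e. the minimum total edge cost of a connected subgraph of $G_{\theta'}$ containing $S\cup\{s\}$ (nodes outside $S$ may be used as intermediate nodes; $v(\emptyset)=0$). For $i\in g(\theta')$ set $$x_i(\theta')=\sum_{S\subseteq g(\theta')\setminus\{i\}}\frac{|S|!\,(|g(\theta')|-|S|-1)!}{|g(\theta')|!}\,\bigl(v(S\cup\{i\})-v(S)\bigr),$$ and $x_i(\theta')=0$ for $i\in V\setminus g(\theta')$. *)

theory Defs
  imports Complex_Main "HOL-Library.FuncSet"
begin

text \<open>Edges are unordered pairs, i.e. sets \<^term>\<open>{i, j}\<close>. Loops (the case \<^term>\<open>i = j\<close>) are allowed.\<close>

definition weighted_graph ::
  "'a set \<Rightarrow> 'a \<Rightarrow> 'a set set \<Rightarrow> ('a set \<Rightarrow> real) \<Rightarrow> bool" where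
  "weighted_graph V s E c \<longleftrightarrow>
     finite V \<and> s \<notin> V \<and>
     E \<subseteq> {{i, j} | i j. i \<in> V \<union> {s} \<and> j \<in> V \<union> {s}} \<and>
     (\<forall>e\<in>E. 0 \<le> c e)"

type_synonym 'a profile = "'a \<Rightarrow> 'a set set"

definition profiles :: "'a set \<Rightarrow> 'a \<Rightarrow> 'a set set \<Rightarrow> 'a profile set" where
  "profiles V s E = (\<Pi>\<^sub>E i\<in>V \<union> {s}. Pow {e \<in> E. i \<in> e})"

definition induced_edges :: "'a set set \<Rightarrow> 'a profile \<Rightarrow> 'a set set" where
  "induced_edges E \<theta> = {{i, j} | i j. {i, j} \<in> E \<and> {i, j} \<in> \<theta> i \<inter> \<theta> j}"

text \<open>Prim's algorithm started at \<^term>\<open>s\<close> on the graph with edge set \<^term>\<open>F\<close>. A state consists of the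
  vertices and the edges of the tree grown so far. Among several cheapest edges leaving the tree,
  the algorithm may choose any one, so this is a relation rather than a function.\<close>

inductive prim_state ::
  "'a set set \<Rightarrow> ('a set \<Rightarrow> real) \<Rightarrow> 'a \<Rightarrow> 'a set \<Rightarrow> 'a set set \<Rightarrow> bool"
  for F c s where
  start: "prim_state F c s {s} {}"
| grow: "\<lbrakk>prim_state F c s W T; u \<in> W; w \<notin> W; {u, w} \<in> F;
          \<And>a b. a \<in> W \<Longrightarrow> b \<notin> W \<Longrightarrow> {a, b} \<in> F \<Longrightarrow> c {u, w} \<le> c {a, b}\<rbrakk>
         \<Longrightarrow> prim_state F c s (insert w W) (insert {u, w} T)"

definition prim_output ::
  "'a set set \<Rightarrow> ('a set \<Rightarrow> real) \<Rightarrow> 'a \<Rightarrow> 'a set \<Rightarrow> 'a set set \<Rightarrow> bool" where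
  "prim_output F c s W T \<longleftrightarrow>
     prim_state F c s W T \<and> \<not> (\<exists>a b. a \<in> W \<and> b \<notin> W \<and> {a, b} \<in> F)"

definition connected_graph :: "'a set \<Rightarrow> 'a set set \<Rightarrow> bool" where
  "connected_graph W H \<longleftrightarrow> (\<forall>a\<in>W. \<forall>b\<in>W. (a, b) \<in> {(i, j). {i, j} \<in> H}\<^sup>*)"

definition subgraph :: "'a set \<Rightarrow> 'a set set \<Rightarrow> 'a set \<Rightarrow> 'a set set \<Rightarrow> bool" where
  "subgraph W H U F \<longleftrightarrow> W \<subseteq> U \<and> H \<subseteq> F \<and> (\<forall>e\<in>H. e \<subseteq> W)"

text \<open>The minimum cost of connecting \<^term>\<open>S\<close> to \<^term>\<open>s\<close> in the graph with vertex set \<^term>\<open>U\<close> and edge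
  set \<^term>\<open>F\<close>. It is meaningful only if \<^term>\<open>S\<close> lies in the component of \<^term>\<open>s\<close>; otherwise the
  minimum is over the empty set.\<close>

definition connection_cost ::
  "'a set \<Rightarrow> 'a set set \<Rightarrow> ('a set \<Rightarrow> real) \<Rightarrow> 'a \<Rightarrow> 'a set \<Rightarrow> real" where
  "connection_cost U F c s S =
     Min {\<Sum>e\<in>H. c e | W H. subgraph W H U F \<and> connected_graph W H \<and> S \<union> {s} \<subseteq> W}"

definition average_marginal_cost :: "'a set \<Rightarrow> ('a set \<Rightarrow> real) \<Rightarrow> 'a \<Rightarrow> real" where
  "average_marginal_cost N v i =
     (\<Sum>S\<in>Pow (N - {i}). fact (card S) * fact (card N - card S - 1) / fact (card N)
        * (v (S \<union> {i}) - v S))"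

text \<open>Every tie-breaking in Prim's algorithm is admitted, so this is a predicate on mechanisms.\<close>

definition AMCM ::
  "'a set \<Rightarrow> 'a \<Rightarrow> 'a set set \<Rightarrow> ('a set \<Rightarrow> real) \<Rightarrow>
   ('a profile \<Rightarrow> 'a set) \<Rightarrow> ('a profile \<Rightarrow> 'a set set) \<Rightarrow> ('a \<Rightarrow> 'a profile \<Rightarrow> real) \<Rightarrow> bool" where
  "AMCM V s E c g f x \<longleftrightarrow>
     (\<forall>\<theta>\<in>profiles V s E.
        (\<exists>W. prim_output (induced_edges E \<theta>) c s W (f \<theta>) \<and> g \<theta> = W - {s}) \<and>
        (\<forall>i\<in>V. x i \<theta> =
           (if i \<in> g \<theta>
            then average_marginal_cost (g \<theta>) (connection_cost (V \<union> {s}) (induced_edges E \<theta>) c s) i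
            else 0)))"

lemma prim_output_exists:
  assumes "finite F" "\<And>e. e \<in> F \<Longrightarrow> finite e"
  shows "\<exists>W T. prim_output F c s W T"
proof -
  let ?R = "{W. \<exists>T. prim_state F c s W T}"
  have "W \<subseteq> insert s (\<Union>F)" if "prim_state F c s W T" for W T
    using that by induction auto
  then have "?R \<subseteq> Pow (insert s (\<Union>F))" by blast
  moreover have "finite (Pow (insert s (\<Union>F)))" using assms by simp
  ultimately have "finite ?R" by (rule finite_subset)
  moreover have "?R \<noteq> {}" using prim_state.start[of F c s] by blast
  ultimately obtain W where W: "W \<in> ?R" "\<And>W'. W' \<in> ?R \<Longrightarrow> W \<subseteq> W' \<Longrightarrow> W = W'"
    using finite_has_maximal[of ?R] by blast
  then obtain T where T: "prim_state F c s W T" by blast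
  have False if ab: "a \<in> W" "b \<notin> W" "{a, b} \<in> F" for a b
  proof -
    let ?C = "{e \<in> F. \<exists>a b. e = {a, b} \<and> a \<in> W \<and> b \<notin> W}"
    have "finite ?C" "?C \<noteq> {}" using assms ab by auto
    then obtain e where e: "e \<in> ?C" "\<forall>e'\<in>?C. c e \<le> c e'"
      by (metis (no_types, lifting) arg_min_if_finite(1) arg_min_least)
    then obtain u w where uw: "e = {u, w}" "u \<in> W" "w \<notin> W" "{u, w} \<in> F" by blast
    have "c {u, w} \<le> c {a', b'}" if "a' \<in> W" "b' \<notin> W" "{a', b'} \<in> F" for a' b'
    proof -
      have "{a', b'} \<in> ?C" using that by blast
      then show ?thesis using e(2) uw(1) by (simp only:)
    qed
    then have "prim_state F c s (insert w W) (insert {u, w} T)"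
      by (rule prim_state.grow[OF T uw(2-4)])
    then show False using W(2)[of "insert w W"] uw(3) by (metis insertI1 mem_Collect_eq subset_insertI)
  qed
  then have "prim_output F c s W T" using T unfolding prim_output_def by metis
  then show ?thesis by (intro exI)
qed

lemma AMCM_exists:
  assumes "weighted_graph V s E c"
  shows "\<exists>g f x. AMCM V s E c g f x"
proof -
  have E: "E \<subseteq> Pow (V \<union> {s})" and V: "finite V"
    using assms by (auto simp: weighted_graph_def)
  have sub: "induced_edges E \<theta> \<subseteq> E" for \<theta>
    by (auto simp: induced_edges_def)
  have "finite (induced_edges E \<theta>)" for \<theta>
    using finite_subset[OF subset_trans[OF sub E]] V by simp
  moreover have "finite e" if "e \<in> induced_edges E \<theta>" for \<theta> e
  proof (rule finite_subset)
    show "e \<subseteq> V \<union> {s}" using that sub E by blast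
  qed (use V in simp)
  ultimately have "\<exists>W T. prim_output (induced_edges E \<theta>) c s W T" for \<theta>
    by (rule prim_output_exists)
  then obtain W T where WT: "\<And>\<theta>. prim_output (induced_edges E \<theta>) c s (W \<theta>) (T \<theta>)"
    by metis
  define g where "g = (\<lambda>\<theta>. W \<theta> - {s})"
  define x where "x = (\<lambda>i \<theta>. if i \<in> g \<theta>
    then average_marginal_cost (g \<theta>) (connection_cost (V \<union> {s}) (induced_edges E \<theta>) c s) i
    else 0)"
  have "AMCM V s E c g T x"
    unfolding AMCM_def
  proof (intro ballI conjI)
    fix \<theta>
    show "\<exists>W. prim_output (induced_edges E \<theta>) c s W (T \<theta>) \<and> g \<theta> = W - {s}"
      using WT[of \<theta>] unfolding g_def by (intro exI[of _ "W \<theta>"] conjI refl)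
  qed (simp add: x_def)
  then show ?thesis by (intro exI)
qed

end

theory Submission
  imports Defs
begin

text \<open>The shares are the Shapley value of the connection cost game \<open>v\<close> on the connected nodes \<open>N\<close>,
  so they add up to \<open>v N - v {}\<close>, where \<open>v {} = 0\<close>. It remains to see that the Prim tree attains
  \<open>v N\<close>: by the exchange argument, any connected competitor can be transformed, without raising its
  cost, into one that contains the whole tree.\<close>

section \<open>Efficiency of the Shapley value\<close>

text \<open>Swap the sums over players and coalitions and collect the coefficient of each
  \<open>v S\<close>. It enters positively once for each member of \<open>S\<close> and negatively
  once for each player outside \<open>S\<close>. Both totals equal \<open>q (card S)\<close>, so
  only the two extreme coalitions survive.\<close>

lemma sum_average_marginal_cost:
  fixes v :: "'a set \<Rightarrow> real"
  assumes N: "finite N"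
  shows "(\<Sum>i\<in>N. average_marginal_cost N v i) = v N - v {}"
proof -
  define n where "n = card N"
  define w :: "nat \<Rightarrow> real" where "w k = fact k * fact (n - k - 1) / fact n" for k
  define q :: "nat \<Rightarrow> real" where "q k = fact k * fact (n - k) / fact n" for k
  have joined: "(\<Sum>S\<in>Pow (N - {i}). w (card S) * v (S \<union> {i})) =
      (\<Sum>S | S \<in> Pow N \<and> i \<in> S. w (card S - 1) * v S)" if "i \<in> N" for i
  proof (rule sum.reindex_bij_witness[of _ "\<lambda>S. S - {i}" "insert i"])
    fix S assume "S \<in> Pow (N - {i})"
    then have "finite S" "i \<notin> S" using N finite_subset by auto
    then show "w (card (insert i S) - 1) * v (insert i S) = w (card S) * v (S \<union> {i})" by simp
  qed (use that in auto)
  have unjoined: "Pow (N - {i}) = {S \<in> Pow N. i \<notin> S}" for i by auto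
  \<comment> \<open>At \<open>k = 0\<close> the truncated \<open>k - 1\<close> is harmless because
    of the factor \<open>k\<close>. As \<open>q 0\<close> is nonzero, the case split is genuine; it
    singles out the empty coalition here and \<open>N\<close> in \<open>sw2\<close>.\<close>
  have sw1: "k * w (k - 1) = (if k = 0 then 0 else q k)" for k :: nat
    by (cases k) (simp_all add: w_def q_def)
  have sw2: "real (n - k) * w k = (if n - k = 0 then 0 else q k)" for k
    by (cases "n - k") (simp_all add: w_def q_def)
  have "(\<Sum>i\<in>N. average_marginal_cost N v i) =
      (\<Sum>i\<in>N. \<Sum>S\<in>Pow (N - {i}). w (card S) * v (S \<union> {i})) -
      (\<Sum>i\<in>N. \<Sum>S\<in>Pow (N - {i}). w (card S) * v S)"
    by (simp add: average_marginal_cost_def w_def n_def right_diff_distrib sum_subtractf)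
  also have "(\<Sum>i\<in>N. \<Sum>S\<in>Pow (N - {i}). w (card S) * v (S \<union> {i})) =
      (\<Sum>i\<in>N. \<Sum>S | S \<in> Pow N \<and> i \<in> S. w (card S - 1) * v S)"
    by (intro sum.cong refl joined)
  also have "\<dots> = (\<Sum>S\<in>Pow N. \<Sum>i | i \<in> N \<and> i \<in> S. w (card S - 1) * v S)"
    using N by (intro sum.swap_restrict) auto
  also have "\<dots> = (\<Sum>S\<in>Pow N. (if S = {} then 0 else q (card S)) * v S)"
  proof (rule sum.cong[OF refl])
    fix S assume S: "S \<in> Pow N"
    then have "{i. i \<in> N \<and> i \<in> S} = S" and "finite S" using N finite_subset by auto
    then show "(\<Sum>i | i \<in> N \<and> i \<in> S. w (card S - 1) * v S) =
        (if S = {} then 0 else q (card S)) * v S"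
      using sw1[of "card S"] by (simp flip: mult.assoc)
  qed
  also have "(\<Sum>i\<in>N. \<Sum>S\<in>Pow (N - {i}). w (card S) * v S) =
      (\<Sum>S\<in>Pow N. \<Sum>i | i \<in> N \<and> i \<notin> S. w (card S) * v S)"
    unfolding unjoined using N sum.swap_restrict[of N "Pow N" "\<lambda>i S. w (card S) * v S" "\<lambda>i S. i \<notin> S"]
    by simp
  also have "\<dots> = (\<Sum>S\<in>Pow N. (if S = N then 0 else q (card S)) * v S)"
  proof (rule sum.cong[OF refl])
    fix S assume S: "S \<in> Pow N"
    have "{i. i \<in> N \<and> i \<notin> S} = N - S" by auto
    moreover have "card (N - S) = n - card S"
      unfolding n_def using S N finite_subset by (intro card_Diff_subset) auto
    moreover have "n - card S = 0 \<longleftrightarrow> S = N"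
      using S N card_seteq[of N S] by (auto simp: n_def)
    ultimately show "(\<Sum>i | i \<in> N \<and> i \<notin> S. w (card S) * v S) =
        (if S = N then 0 else q (card S)) * v S"
      using sw2[of "card S"] by (simp flip: mult.assoc)
  qed
  \<comment> \<open>If \<open>N\<close> is empty, both exceptions fall on the same coalition and the
    two sides still agree.\<close>
  also have "(\<Sum>S\<in>Pow N. (if S = {} then 0 else q (card S)) * v S) -
      (\<Sum>S\<in>Pow N. (if S = N then 0 else q (card S)) * v S) =
      (\<Sum>S\<in>Pow N. (if S = N then q n * v N else 0) - (if S = {} then q 0 * v {} else 0))"
    unfolding sum_subtractf[symmetric] by (intro sum.cong) (auto simp: n_def)
  also have "\<dots> = q n * v N - q 0 * v {}"
    using N by (simp add: sum_subtractf)
  also have "\<dots> = v N - v {}" by (simp add: q_def)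
  finally show ?thesis .
qed

section \<open>Optimality of Prim trees\<close>

text \<open>The closure inside \<open>connected_graph\<close>, detached from the vertex set, so that
  connectivity can be followed while only the edge set changes.\<close>

definition reach :: "'a set set \<Rightarrow> ('a \<times> 'a) set" where
  "reach H = {(i, j). {i, j} \<in> H}\<^sup>*"

lemma reach_refl: "(a, a) \<in> reach H"
  by (simp add: reach_def)

lemma reach_edge: "{a, b} \<in> H \<Longrightarrow> (a, b) \<in> reach H"
  by (auto simp: reach_def)

lemma reach_trans: "(a, b) \<in> reach H \<Longrightarrow> (b, d) \<in> reach H \<Longrightarrow> (a, d) \<in> reach H"
  by (simp add: reach_def)

lemma reach_sym: "(a, b) \<in> reach H \<Longrightarrow> (b, a) \<in> reach H"
proof -
  have "sym {(i, j). {i, j} \<in> H}" by (auto simp: sym_def insert_commute)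
  then show "(a, b) \<in> reach H \<Longrightarrow> (b, a) \<in> reach H"
    unfolding reach_def by (meson sym_rtrancl symD)
qed

lemma reach_mono: "H \<subseteq> H' \<Longrightarrow> (a, b) \<in> reach H \<Longrightarrow> (a, b) \<in> reach H'"
  unfolding reach_def by (rule rtrancl_mono[THEN subsetD]) auto

text \<open>A path survives if each of its edges has a detour; this is what permits deleting an edge
  in the exchange.\<close>

lemma reach_subst:
  assumes "(x, y) \<in> reach H" and "\<And>a b. {a, b} \<in> H \<Longrightarrow> (a, b) \<in> reach H'"
  shows "(x, y) \<in> reach H'"
  using assms(1) unfolding reach_def
proof (induction rule: rtrancl_induct)
  case (step y z)
  then show ?case using assms(2)[of y z] by (auto simp: reach_def)
qed simp

text \<open>Follow the path from \<open>w\<close> up to its first entry into \<open>W\<close>, which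
  happens along \<open>{a, b}\<close>. The stretch before it avoids \<open>W\<close>, so it remains
  available when \<open>{a, b}\<close> is deleted.\<close>

lemma reach_cross:
  assumes "(w, u) \<in> reach H" "w \<notin> W" "u \<in> W"
  obtains a b where "a \<in> W" "b \<notin> W" "{a, b} \<in> H" "(w, b) \<in> reach {e \<in> H. e \<inter> W = {}}"
proof -
  have "u \<in> W \<Longrightarrow> w \<notin> W \<Longrightarrow>
    \<exists>a b. a \<in> W \<and> b \<notin> W \<and> {a, b} \<in> H \<and> (w, b) \<in> reach {e \<in> H. e \<inter> W = {}}"
    using assms(1) unfolding reach_def[of H]
  proof (induction rule: converse_rtrancl_induct)
    case (step y z)
    show ?case
    proof (cases "z \<in> W")
      case True
      then have "{z, y} \<in> H" using step.hyps by (auto simp: insert_commute)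
      then show ?thesis using True step.prems reach_refl[of y] by blast
    next
      case False
      then have "(y, z) \<in> reach {e \<in> H. e \<inter> W = {}}"
        using step.hyps step.prems by (intro reach_edge) auto
      then show ?thesis using step.IH False step.prems by (meson reach_trans)
    qed
  qed simp
  then show thesis using assms that by blast
qed

lemma connected_graphI:
  assumes "\<And>a. a \<in> W \<Longrightarrow> (s, a) \<in> reach H"
  shows "connected_graph W H"
  using assms reach_sym reach_trans unfolding connected_graph_def reach_def by metis

text \<open>Invariants of the growth. That tree edges stay inside \<open>W\<close> protects them
  when an edge leaving \<open>W\<close> is deleted, and reachability within \<open>T\<close>
  supplies part of the bypass.\<close>

lemma prim_state_tree:
  assumes "prim_state F c s W T"
  shows "s \<in> W" "T \<subseteq> F" "\<And>e. e \<in> T \<Longrightarrow> e \<subseteq> W" "\<And>a. a \<in> W \<Longrightarrow> (s, a) \<in> reach T" "W \<subseteq> insert s (\<Union>F)"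
proof -
  have "s \<in> W \<and> T \<subseteq> F \<and> (\<forall>e\<in>T. e \<subseteq> W) \<and> (\<forall>a\<in>W. (s, a) \<in> reach T) \<and> W \<subseteq> insert s (\<Union>F)"
    using assms
  proof induction
    case start
    then show ?case by (simp add: reach_refl)
  next
    case (grow W T u w)
    let ?T = "insert {u, w} T"
    have "(s, a) \<in> reach ?T" if "a \<in> W" for a
      using grow.IH that reach_mono[of T ?T] by blast
    moreover from this have "(s, w) \<in> reach ?T"
      using reach_edge[of u w ?T] grow.hyps(2) by (meson insertI1 reach_trans)
    moreover have "\<forall>e\<in>?T. e \<subseteq> insert w W" using grow.IH grow.hyps(2) by auto
    moreover have "insert w W \<subseteq> insert s (\<Union>F)" using grow.IH grow.hyps(4) by auto
    ultimately show ?case using grow.IH grow.hyps(4) by simp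
  qed
  then show "s \<in> W" "T \<subseteq> F" "\<And>e. e \<in> T \<Longrightarrow> e \<subseteq> W" "\<And>a. a \<in> W \<Longrightarrow> (s, a) \<in> reach T" "W \<subseteq> insert s (\<Union>F)"
    by simp_all
qed

text \<open>Induction on the growth of the tree: a missing new edge is swapped for an edge of the
  competitor that leaves \<open>W\<close>, which is no cheaper by the greedy choice. The set
  \<open>X\<close> stays fixed while \<open>W\<close> grows, so the competitor from the induction
  hypothesis already reaches the new vertex \<open>w\<close>.\<close>

lemma prim_state_exchange:
  assumes "prim_state F c s W T" "finite F" "H \<subseteq> F" "W \<subseteq> X" "\<And>a. a \<in> X \<Longrightarrow> (s, a) \<in> reach H"
  shows "\<exists>H'. H' \<subseteq> F \<and> T \<subseteq> H' \<and> (\<forall>a\<in>X. (s, a) \<in> reach H') \<and> sum c H' \<le> sum c H"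
  using assms(1,4)
proof induction
  case start
  then show ?case using assms by blast
next
  case (grow W T u w)
  then obtain H' where H': "H' \<subseteq> F" "T \<subseteq> H'" "\<And>a. a \<in> X \<Longrightarrow> (s, a) \<in> reach H'"
      "sum c H' \<le> sum c H" by auto
  note tree = prim_state_tree[OF grow.hyps(1)]
  show ?case
  proof (cases "{u, w} \<in> H'")
    case True
    then show ?thesis using H' by blast
  next
    case False
    have "(w, u) \<in> reach H'"
    proof (rule reach_trans[OF reach_sym])
      show "(s, w) \<in> reach H'" "(s, u) \<in> reach H'" using H'(3) grow.prems grow.hyps(2) by auto
    qed
    from this grow.hyps(3,2) obtain a b where ab: "a \<in> W" "b \<notin> W" "{a, b} \<in> H'"
        "(w, b) \<in> reach {e \<in> H'. e \<inter> W = {}}"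
      by (rule reach_cross)
    define K where "K = insert {u, w} (H' - {{a, b}})"
    \<comment> \<open>The deleted edge has the endpoint \<open>b\<close> outside \<open>W\<close>,
      so it is not a tree edge.\<close>
    have TK: "T \<subseteq> K" using H'(2) tree(3) ab(2) unfolding K_def by blast
    \<comment> \<open>The removed edge is bypassed by walking back inside the tree, along the new edge, and then
      outside \<open>W\<close>.\<close>
    have "(a, u) \<in> reach T" using tree(4) ab(1) grow.hyps(2) by (meson reach_sym reach_trans)
    then have "(a, u) \<in> reach K" by (rule reach_mono[OF TK])
    moreover have "(u, w) \<in> reach K" by (intro reach_edge) (simp add: K_def)
    moreover have "(w, b) \<in> reach K"
      by (rule reach_mono[OF _ ab(4)]) (use ab(1) in \<open>auto simp: K_def\<close>)
    ultimately have abK: "(a, b) \<in> reach K" by (meson reach_trans)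
    have step: "(i, j) \<in> reach K" if "{i, j} \<in> H'" for i j
    proof (cases "{i, j} = {a, b}")
      case True
      then show ?thesis using abK reach_sym by (auto simp: doubleton_eq_iff)
    next
      case False
      then show ?thesis using that by (intro reach_edge) (simp add: K_def)
    qed
    have fin: "finite H'" using H'(1) assms(2) finite_subset by blast
    have "sum c K = c {u, w} + (sum c H' - c {a, b})"
      using False fin ab(3) by (simp add: K_def sum_diff1)
    also have "c {u, w} \<le> c {a, b}" using grow.hyps(5) ab H'(1) by blast
    finally have "sum c K \<le> sum c H" using H'(4) by simp
    moreover have "K \<subseteq> F" using H'(1) grow.hyps(4) by (auto simp: K_def)
    moreover have "insert {u, w} T \<subseteq> K" using TK by (simp add: K_def)
    moreover have "\<forall>a\<in>X. (s, a) \<in> reach K" using reach_subst[OF H'(3) step] by blast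
    ultimately show ?thesis by blast
  qed
qed

text \<open>Exchange with \<open>X = W\<close>, then drop the surplus edges of \<open>H'\<close>,
  which have nonnegative cost.\<close>

lemma prim_state_minimal:
  assumes "prim_state F c s W T" "finite F" "\<And>e. e \<in> F \<Longrightarrow> 0 \<le> c e"
    and "H \<subseteq> F" "\<And>a. a \<in> W \<Longrightarrow> (s, a) \<in> reach H"
  shows "sum c T \<le> sum c H"
proof -
  obtain H' where H': "H' \<subseteq> F" "T \<subseteq> H'" "sum c H' \<le> sum c H"
    using prim_state_exchange[OF assms(1,2,4) subset_refl assms(5)] by blast
  have "sum c T \<le> sum c H'"
    using H' assms(2,3) finite_subset by (intro sum_mono2) auto
  then show ?thesis using H'(3) by simp
qed

text \<open>Partial trees are covered too: the final tree yields the value of the grand coalition,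
  the start state that of the empty one. Competitors may pass through vertices outside
  \<open>W\<close>, since minimality only asks them to reach all of \<open>W\<close>.\<close>

lemma connection_cost_prim_state:
  assumes "prim_state F c s W T" "finite F" "\<And>e. e \<in> F \<Longrightarrow> 0 \<le> c e"
    and "W \<subseteq> U" "S \<union> {s} = W"
  shows "connection_cost U F c s S = sum c T"
  unfolding connection_cost_def
proof (rule Min_eqI)
  let ?C = "{sum c H | W H. subgraph W H U F \<and> connected_graph W H \<and> S \<union> {s} \<subseteq> W}"
  \<comment> \<open>Costs depend on the edge set alone, so there are finitely many, whatever the
    vertex sets.\<close>
  have "?C \<subseteq> sum c ` Pow F" by (auto simp: subgraph_def)
  then show "finite ?C" using assms(2) finite_subset by blast
  note tree = prim_state_tree[OF assms(1)]
  have "connected_graph W T" by (rule connected_graphI[OF tree(4)])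
  moreover have "subgraph W T U F" using tree(2,3) assms(4) by (simp add: subgraph_def)
  ultimately show "sum c T \<in> ?C" using assms(5) by auto
  fix y assume "y \<in> ?C"
  then obtain W' H where H: "y = sum c H" "subgraph W' H U F" "connected_graph W' H" "S \<union> {s} \<subseteq> W'"
    by blast
  have "(s, a) \<in> reach H" if "a \<in> W" for a
    using H(3,4) assms(5) that unfolding connected_graph_def reach_def by blast
  moreover have "H \<subseteq> F" using H(2) by (simp add: subgraph_def)
  ultimately show "sum c T \<le> y"
    using prim_state_minimal[OF assms(1-3)] H(1) by blast
qed

theorem theorem4p3:
  fixes V :: "'a set" and s :: 'a and E :: "'a set set" and c :: "'a set \<Rightarrow> real"
    and g :: "'a profile \<Rightarrow> 'a set" and f :: "'a profile \<Rightarrow> 'a set set"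
    and x :: "'a \<Rightarrow> 'a profile \<Rightarrow> real"
  assumes "weighted_graph V s E c"
    and "AMCM V s E c g f x"
  shows "\<forall>\<theta>\<in>profiles V s E. (\<Sum>i\<in>V. x i \<theta>) = (\<Sum>e\<in>f \<theta>. c e)"
proof
  fix \<theta> assume \<theta>: "\<theta> \<in> profiles V s E"
  define F where "F = induced_edges E \<theta>"
  define U where "U = V \<union> {s}"
  define v where "v = connection_cost U F c s"
  have V: "finite V" and E: "E \<subseteq> Pow U" and c: "\<And>e. e \<in> E \<Longrightarrow> 0 \<le> c e"
    using assms(1) by (auto simp: weighted_graph_def U_def)
  have FE: "F \<subseteq> E" by (auto simp: F_def induced_edges_def)
  have "finite E" by (rule finite_subset[OF E]) (use V in \<open>simp add: U_def\<close>)
  then have F: "finite F" "\<And>e. e \<in> F \<Longrightarrow> 0 \<le> c e"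
    using FE c finite_subset by auto
  obtain W where prim: "prim_state F c s W (f \<theta>)" and gW: "g \<theta> = W - {s}"
    using assms(2) \<theta> unfolding AMCM_def prim_output_def F_def by meson
  have x: "x i \<theta> = (if i \<in> g \<theta> then average_marginal_cost (g \<theta>) v i else 0)" if "i \<in> V" for i
    using assms(2) \<theta> that unfolding AMCM_def F_def v_def U_def by blast
  have W: "W \<subseteq> U" "s \<in> W"
    using prim_state_tree(1,5)[OF prim] FE E by (auto simp: U_def)
  then have gV: "g \<theta> \<subseteq> V" by (auto simp: gW U_def)
  have "(\<Sum>i\<in>V. x i \<theta>) = (\<Sum>i\<in>g \<theta>. x i \<theta>)"
    using V gV x by (intro sum.mono_neutral_right) auto
  also have "\<dots> = (\<Sum>i\<in>g \<theta>. average_marginal_cost (g \<theta>) v i)"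
    using x gV by (intro sum.cong) auto
  also have "\<dots> = v (g \<theta>) - v {}"
    by (rule sum_average_marginal_cost[OF finite_subset[OF gV V]])
  also have "v (g \<theta>) = sum c (f \<theta>)"
    unfolding v_def using W by (intro connection_cost_prim_state[OF prim F]) (auto simp: gW)
  \<comment> \<open>The start state spans \<open>{s}\<close> with no edges, so its cost is an empty
    sum.\<close>
  also have "v {} = 0"
    unfolding v_def using connection_cost_prim_state[OF prim_state.start F, where U = U and S = "{}"]
    by (simp add: U_def)
  finally show "(\<Sum>i\<in>V. x i \<theta>) = (\<Sum>e\<in>f \<theta>. c e)" by simp
qed

end
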